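(* Let $g,r\in\mathcal{F}$, let $\mathbf{z}=(z_1,z_2)$ be the periodic solution, with period $T$, of $$z_1'=-\partial_2 g(\mathbf{z}),\quad z_2'=\partial_1 g(\mathbf{z}),\quad \mathbf{z}(0)=\mathbf{x}_0,$$ and, for $|\lambda|$ small, let $\mathbf{z}_\lambda$ be the periodic solution, with period $T_\lambda$, of the same system with $g$ replaced by $g+\lambda r$ and the same initial condition $\mathbf{z}_\lambda(0)=\mathbf{x}_0$. Let $\mathbf{w}=(w_1,w_2)$ be the solution on $[0,T]$ of $$w_1'=-\nabla\partial_2 g(\mathbf{z})\cdot\mathbf{w}-\partial_2 r(\mathbf{z}),\quad w_2'=\nabla\partial_1 g(\mathbf{z})\cdot\mathbf{w}+\partial_1 r(\mathbf{z}),\quad w_1(0)=w_2(0)=0.$$ If $z_2'(T)\ne0$, then $$\lim_{\lambda\to0}\frac{T_\lambda-T}{\lambda}=-\frac{w_2(T)}{z_2'(T)}.$$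
   Context: $D\subset\mathbb{R}^2$ is a bounded domain with $\mathcal{C}^{1,1}$ boundary, and $\mathbf{x}_0\in D$ is a fixed given point. $\mathcal{F}\subset\mathcal{C}^2(\overline{D})$ is a family of functions such that every $g\in\mathcal{F}$ satisfies: $g(\mathbf{x}_0)=0$; $|\nabla g(\mathbf{x})|>0$ for all $\mathbf{x}\in D$ with $g(\mathbf{x})=0$; and $g(\mathbf{x})>0$ for all $\mathbf{x}\in\partial D$. Here $\partial_i=\partial/\partial x_i$. Under these conditions the Hamiltonian trajectory through $\mathbf{x}_0$ is periodic. For $|\lambda|$ small the function $g+\lambda r$ satisfies the same three conditions, so $\mathbf{z}_\lambda$ is also periodic. "Period" means the minimal positive period. *)

theory Defs
  imports "HOL-Analysis.Analysis"
begin

text \<open>Partial derivatives, taken along coordinate lines.  They are only ever used at points of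
  the open set \<open>D\<close>.\<close>

definition pd :: "2 \<Rightarrow> (real^2 \<Rightarrow> real) \<Rightarrow> real^2 \<Rightarrow> real" where
  "pd i g x = deriv (\<lambda>s. g (x + s *\<^sub>R axis i 1)) 0"

definition grad :: "(real^2 \<Rightarrow> real) \<Rightarrow> real^2 \<Rightarrow> real^2" where
  "grad g x = (\<chi> i. pd i g x)"

text \<open>The space of functions that are twice continuously differentiable in the open set \<open>D\<close>,
  with the function, its gradient and its Hessian extending continuously to the closure.
  Functions are total on the plane, but only their values on the closure of \<open>D\<close> matter.
  The values of \<open>G\<close> and \<open>H\<close> on the frontier are the continuous extensions.\<close>

definition C2_closure :: "(real^2) set \<Rightarrow> (real^2 \<Rightarrow> real) set" where
  "C2_closure D = {g. continuous_on (closure D) g \<and>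
     (\<exists>(G :: real^2 \<Rightarrow> real^2) (H :: real^2 \<Rightarrow> real^2^2).
        continuous_on (closure D) G \<and> continuous_on (closure D) H \<and>
        (\<forall>x\<in>D. GDERIV g x :> G x \<and> (G has_derivative (\<lambda>h. H x *v h)) (at x)))}"

definition C11_function :: "(real \<Rightarrow> real) \<Rightarrow> bool" where
  "C11_function \<phi> \<longleftrightarrow>
     (\<exists>\<phi>' L. (\<forall>s. (\<phi> has_real_derivative \<phi>' s) (at s)) \<and> L-lipschitz_on UNIV \<phi>')"

text \<open>Near each frontier point, in suitable Cartesian coordinates (along the orthonormal vectors
  \<open>u\<close> and \<open>v\<close>), \<open>D\<close> is the strict epigraph of a \<open>C\<^sup>1\<^sup>,\<^sup>1\<close> function.  For open \<open>D\<close> this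
  forces the frontier to be locally the graph, with \<open>D\<close> on one side only.  Taking the function
  on the whole line is no restriction, as it can be extended affinely outside a compact interval.\<close>

definition C11_boundary :: "(real^2) set \<Rightarrow> bool" where
  "C11_boundary D \<longleftrightarrow>
     (\<forall>p\<in>frontier D. \<exists>\<rho>>0. \<exists>u v \<phi>. norm u = 1 \<and> norm v = 1 \<and> u \<bullet> v = 0 \<and> C11_function \<phi> \<and>
        (\<forall>y\<in>ball p \<rho>. y \<in> D \<longleftrightarrow> \<phi> (y \<bullet> u) < y \<bullet> v))"

definition admissible :: "(real^2) set \<Rightarrow> real^2 \<Rightarrow> (real^2 \<Rightarrow> real) \<Rightarrow> bool" where
  "admissible D x0 g \<longleftrightarrow>
     g x0 = 0 \<and> (\<forall>x\<in>D. g x = 0 \<longrightarrow> norm (grad g x) > 0) \<and> (\<forall>x\<in>frontier D. g x > 0)"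

definition hamiltonian_solution ::
    "(real^2) set \<Rightarrow> (real^2 \<Rightarrow> real) \<Rightarrow> real^2 \<Rightarrow> (real \<Rightarrow> real^2) \<Rightarrow> bool" where
  "hamiltonian_solution D g x0 z \<longleftrightarrow>
     z 0 = x0 \<and>
     (\<forall>t. z t \<in> D \<and>
        ((\<lambda>s. z s $ 1) has_real_derivative - pd 2 g (z t)) (at t) \<and>
        ((\<lambda>s. z s $ 2) has_real_derivative pd 1 g (z t)) (at t))"

definition is_minimal_period :: "(real \<Rightarrow> 'a) \<Rightarrow> real \<Rightarrow> bool" where
  "is_minimal_period z T \<longleftrightarrow>
     T > 0 \<and> (\<forall>t. z (t + T) = z t) \<and> (\<forall>S. 0 < S \<and> S < T \<longrightarrow> \<not> (\<forall>t. z (t + S) = z t))"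

definition linearized_solution ::
    "(real^2 \<Rightarrow> real) \<Rightarrow> (real^2 \<Rightarrow> real) \<Rightarrow> (real \<Rightarrow> real^2) \<Rightarrow> real \<Rightarrow> (real \<Rightarrow> real^2) \<Rightarrow> bool" where
  "linearized_solution g r z T w \<longleftrightarrow>
     w 0 $ 1 = 0 \<and> w 0 $ 2 = 0 \<and>
     (\<forall>t\<in>{0..T}.
        ((\<lambda>s. w s $ 1) has_real_derivative - (grad (pd 2 g) (z t) \<bullet> w t) - pd 2 r (z t))
          (at t within {0..T}) \<and>
        ((\<lambda>s. w s $ 2) has_real_derivative grad (pd 1 g) (z t) \<bullet> w t + pd 1 r (z t))
          (at t within {0..T}))"

end

theory Submission
  imports Defs
begin

text \<open>A Gronwall estimate shows that \<open>zl l - z\<close> is \<open>O(l)\<close> and that \<open>(zl l - z) / l\<close> tends to \<open>w\<close>.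
  Since \<open>z\<close> crosses the horizontal line through \<open>x0\<close> transversally at time \<open>T\<close>, the
  perturbed trajectory crosses it at some time near \<open>T\<close>; by conservation of energy it does so
  at \<open>x0\<close>, whence \<open>Tl l\<close> is at most that time.  It cannot return much earlier, because \<open>z\<close> stays
  away from \<open>x0\<close> in between.  So \<open>Tl l\<close> tends to \<open>T\<close>, and the mean value theorem applied to the
  second component of \<open>zl l\<close> between \<open>T\<close> and \<open>Tl l\<close>, with \<open>zl l (Tl l) = x0 = z T\<close>, gives the limit.\<close>

section \<open>Gronwall's inequality and integral curves of autonomous fields\<close>

text \<open>Weighted by \<open>exp (- (2 * L + 1) * s)\<close>, the quantity
  \<open>u s \<bullet> u s + \<epsilon>\<^sup>2\<close> cannot increase: the product
  \<open>2 * norm (u s) * \<epsilon>\<close> is absorbed by the sum of the two squares. Squaring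
  avoids differentiating the norm at zeros of \<open>u\<close>, at the price of the summand 1/2 in
  the exponent. Derivatives are asked for in the open interval only, since the linearized solution
  has one-sided ones at the endpoints.\<close>

lemma gronwall_norm_bound:
  fixes u u' :: "real \<Rightarrow> 'a::real_inner"
  assumes cont: "continuous_on {0..M} u"
    and der: "\<And>t. \<lbrakk>0 < t; t < M\<rbrakk> \<Longrightarrow> (u has_vector_derivative u' t) (at t)"
    and bound: "\<And>t. \<lbrakk>0 < t; t < M\<rbrakk> \<Longrightarrow> norm (u' t) \<le> L * norm (u t) + \<epsilon>"
    and init: "u 0 = 0" and L: "L \<ge> 0" and \<epsilon>: "\<epsilon> \<ge> 0" and t: "0 \<le> t" "t \<le> M"
  shows "norm (u t) \<le> \<epsilon> * exp ((L + 1/2) * t)"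
proof -
  define c where "c = 2 * L + 1"
  define q where "q = (\<lambda>s. (u s \<bullet> u s + \<epsilon>\<^sup>2) * exp (- (c * s)))"
  have "q 0 \<ge> q t"
  proof (rule DERIV_nonpos_imp_decreasing_open[OF t(1)])
    show "continuous_on {0..t} q"
      unfolding q_def
      by (intro continuous_intros continuous_on_subset[OF cont]) (use t in auto)
    fix s assume s: "0 < s" "s < t"
    then have s': "0 < s" "s < M" using t by auto
    note d = der[OF s', unfolded has_vector_derivative_def]
    have D: "(q has_real_derivative
        (2 * (u s \<bullet> u' s) - c * (u s \<bullet> u s + \<epsilon>\<^sup>2)) * exp (- (c * s))) (at s)"
      unfolding q_def has_field_derivative_def
      by (auto intro!: derivative_eq_intros d simp: fun_eq_iff inner_commute algebra_simps)
    have "u s \<bullet> u' s \<le> norm (u s) * norm (u' s)"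
      by (rule norm_cauchy_schwarz)
    also have "\<dots> \<le> norm (u s) * (L * norm (u s) + \<epsilon>)"
      by (intro mult_left_mono bound s') auto
    finally have "2 * (u s \<bullet> u' s) \<le> 2 * L * (norm (u s))\<^sup>2 + 2 * norm (u s) * \<epsilon>"
      by (simp add: power2_eq_square algebra_simps)
    also have "\<dots> \<le> 2 * L * (norm (u s))\<^sup>2 + ((norm (u s))\<^sup>2 + \<epsilon>\<^sup>2)"
      using sum_squares_bound[of "norm (u s)" \<epsilon>] by simp
    also have "\<dots> \<le> c * ((norm (u s))\<^sup>2 + \<epsilon>\<^sup>2)"
      unfolding c_def using L by (simp add: algebra_simps)
    finally have "2 * (u s \<bullet> u' s) - c * (u s \<bullet> u s + \<epsilon>\<^sup>2) \<le> 0"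
      by (simp add: power2_norm_eq_inner)
    then have "(2 * (u s \<bullet> u' s) - c * (u s \<bullet> u s + \<epsilon>\<^sup>2)) * exp (- (c * s)) \<le> 0"
      by (simp add: mult_nonpos_nonneg)
    with D show "\<exists>y. (q has_real_derivative y) (at s) \<and> y \<le> 0" by blast
  qed
  then have "(u t \<bullet> u t + \<epsilon>\<^sup>2) * exp (- (c * t)) * exp (c * t) \<le> \<epsilon>\<^sup>2 * exp (c * t)"
    unfolding q_def using init by (intro mult_right_mono) auto
  then have "u t \<bullet> u t + \<epsilon>\<^sup>2 \<le> \<epsilon>\<^sup>2 * exp (c * t)"
    by (simp add: mult.assoc flip: exp_add)
  then have "(norm (u t))\<^sup>2 \<le> \<epsilon>\<^sup>2 * exp (c * t)"
    using zero_le_power2[of \<epsilon>] unfolding power2_norm_eq_inner by linarith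
  also have "\<dots> = (\<epsilon> * exp ((L + 1/2) * t))\<^sup>2"
    by (simp add: power_mult_distrib c_def algebra_simps flip: exp_double)
  finally show ?thesis
    by (rule power2_le_imp_le) (use \<epsilon> in auto)
qed

text \<open>Curves exist for all times and stay in \<open>D\<close> by definition, matching
  \<open>hamiltonian_solution\<close>. The field is autonomous, so time shifts of curves are curves
  again.\<close>

definition integral_curve :: "'a::real_normed_vector set \<Rightarrow> ('a \<Rightarrow> 'a) \<Rightarrow> (real \<Rightarrow> 'a) \<Rightarrow> bool" where
  "integral_curve D X z \<longleftrightarrow> (\<forall>t. z t \<in> D \<and> (z has_vector_derivative X (z t)) (at t))"

lemma integral_curveD:
  assumes "integral_curve D X z"
  shows "z t \<in> D" "(z has_vector_derivative X (z t)) (at t)"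
  using assms by (auto simp: integral_curve_def)

lemma integral_curve_continuous_on:
  "integral_curve D X z \<Longrightarrow> continuous_on S z"
  by (meson continuous_at_imp_continuous_on has_vector_derivative_continuous integral_curveD(2))

lemma integral_curve_shift:
  assumes "integral_curve D X z"
  shows "integral_curve D X (\<lambda>t. z (t + s))"
  unfolding integral_curve_def
proof (intro allI conjI)
  fix t
  have "((\<lambda>t. t + s) has_vector_derivative 1) (at t)"
    by (auto intro!: derivative_eq_intros)
  from vector_diff_chain_at[OF this integral_curveD(2)[OF assms]]
  show "((\<lambda>t. z (t + s)) has_vector_derivative X (z (t + s))) (at t)"
    by (simp add: o_def)
qed (rule integral_curveD(1)[OF assms])

lemma periodic_mult:
  fixes z :: "real \<Rightarrow> 'a"
  assumes "\<And>t. z (t + P) = z t"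
  shows "z (t + real n * P) = z t"
proof (induction n)
  case (Suc n)
  show ?case using assms[of "t + real n * P"] Suc by (simp add: algebra_simps)
qed simp

text \<open>The factor \<open>a\<close> will be the crossing speed
  \<open>X (z 0) \<bullet> e\<close>, whose sign is not known; multiplying by it treats upward and
  downward crossings alike.\<close>

lemma integral_curve_inner_increasing:
  assumes y: "integral_curve D V y" and "p < q"
    and pos: "\<And>s. \<lbrakk>p \<le> s; s \<le> q\<rbrakk> \<Longrightarrow> a * (V (y s) \<bullet> e) > 0"
  shows "a * (y p \<bullet> e) < a * (y q \<bullet> e)"
proof (rule DERIV_pos_imp_increasing[OF \<open>p < q\<close>])
  fix s assume "p \<le> s" "s \<le> q"
  moreover have "((\<lambda>s. a * (y s \<bullet> e)) has_real_derivative a * (V (y s) \<bullet> e)) (at s)"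
    using integral_curveD(2)[OF y, of s] unfolding has_vector_derivative_def has_field_derivative_def
    by (auto intro!: derivative_eq_intros simp: fun_eq_iff)
  ultimately show "\<exists>d. ((\<lambda>s. a * (y s \<bullet> e)) has_real_derivative d) (at s) \<and> d > 0"
    using pos by blast
qed

section \<open>C1 vector fields on a bounded open set\<close>

text \<open>Field and derivative are continuous on the compact closure, so both are bounded and
  \<open>X'\<close> is uniformly continuous there. Taking \<open>X'\<close> with values in the
  bounded linear maps makes this a statement about the operator norm.\<close>

locale C1_field =
  fixes D :: "'a::euclidean_space set" and X :: "'a \<Rightarrow> 'a" and X' :: "'a \<Rightarrow> 'a \<Rightarrow>\<^sub>L 'a"
  assumes open_D: "open D" and bounded_D: "bounded D"
    and cont_X: "continuous_on (closure D) X" and cont_X': "continuous_on (closure D) X'"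
    and deriv_X: "\<And>x. x \<in> D \<Longrightarrow> (X has_derivative X' x) (at x)"
begin

lemma compact_closure_D: "compact (closure D)"
  using bounded_D by (simp add: compact_closure)

lemma field_bound:
  obtains B where "B > 0" "\<And>x. x \<in> D \<Longrightarrow> norm (X x) \<le> B"
proof -
  have "bounded (X ` closure D)"
    using compact_closure_D cont_X compact_continuous_image compact_imp_bounded by blast
  then show thesis
    using closure_subset[of D] that unfolding bounded_pos by (auto simp: subset_iff)
qed

lemma derivative_bound:
  obtains B where "B > 0" "\<And>x. x \<in> D \<Longrightarrow> norm (X' x) \<le> B"
proof -
  have "bounded (X' ` closure D)"
    using compact_closure_D cont_X' compact_continuous_image compact_imp_bounded by blast
  then show thesis
    using closure_subset[of D] that unfolding bounded_pos by (auto simp: subset_iff)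
qed

text \<open>Only one of the two points has to stay in the compact set: nearby pairs are handled by the
  mean value inequality, distant ones by boundedness of the field.  This makes a continuation
  argument for perturbed trajectories superfluous.\<close>

lemma lipschitz_from_compact:
  assumes "compact K" "K \<subseteq> D"
  obtains L where "L > 0" "\<And>x y. \<lbrakk>x \<in> K; y \<in> D\<rbrakk> \<Longrightarrow> norm (X y - X x) \<le> L * norm (y - x)"
proof -
  obtain B1 where B1: "B1 > 0" "\<And>x. x \<in> D \<Longrightarrow> norm (X x) \<le> B1"
    using field_bound by blast
  obtain B where B: "B > 0" "\<And>x. x \<in> D \<Longrightarrow> norm (X' x) \<le> B"
    using derivative_bound by blast
  \<comment> \<open>Compactness gives one radius for all points of \<open>K\<close>. The balls are
    convex, as the mean value inequality requires; \<open>D\<close> itself may fail to be.\<close>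
  obtain \<delta> where \<delta>: "\<delta> > 0" "(\<Union>x\<in>K. ball x \<delta>) \<subseteq> D"
    using compact_subset_open_imp_ball_epsilon_subset[OF assms(1) open_D assms(2)] by blast
  define L where "L = max B (2 * B1 / \<delta>)"
  show thesis
  proof (rule that)
    show "L > 0" using B by (simp add: L_def less_max_iff_disj)
    fix x y assume x: "x \<in> K" and y: "y \<in> D"
    show "norm (X y - X x) \<le> L * norm (y - x)"
    proof (cases "dist x y < \<delta>")
      case True
      have "ball x \<delta> \<subseteq> D" using \<delta> x by blast
      then have "norm (X y - X x) \<le> B * norm (y - x)"
        using True \<delta>(1) B(2)
        by (intro differentiable_bound[of "ball x \<delta>" X X'])
          (auto simp: subset_iff norm_blinfun.rep_eq[symmetric] intro: has_derivative_at_withinI deriv_X)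
      also have "\<dots> \<le> L * norm (y - x)"
        by (intro mult_right_mono) (auto simp: L_def)
      finally show ?thesis .
    next
      case False
      have "norm (X y - X x) \<le> 2 * B1"
        using norm_triangle_ineq4[of "X y" "X x"] B1(2)[OF y] B1(2)[of x] x assms(2) by auto
      also have "\<dots> = (2 * B1 / \<delta>) * \<delta>" using \<delta> by simp
      also have "\<dots> \<le> L * norm (y - x)"
        using False B B1 \<delta> by (intro mult_mono) (auto simp: L_def dist_norm norm_minus_commute le_max_iff_disj)
      finally show ?thesis .
    qed
  qed
qed

text \<open>This is the mean value inequality for \<open>\<lambda>y. X y - X' x y\<close>, whose
  derivative \<open>X' s - X' x\<close> is small near \<open>x\<close>, uniformly in
  \<open>x\<close>, by uniform continuity of \<open>X'\<close>. The radius \<open>d\<close> is small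
  enough to force \<open>y\<close> into \<open>D\<close>.\<close>

lemma uniform_linearization:
  assumes "compact K" "K \<subseteq> D" "e > 0"
  obtains d where "d > 0"
    "\<And>x y. \<lbrakk>x \<in> K; norm (y - x) < d\<rbrakk> \<Longrightarrow> norm (X y - X x - X' x (y - x)) \<le> e * norm (y - x)"
proof -
  obtain \<delta> where \<delta>: "\<delta> > 0" "(\<Union>x\<in>K. ball x \<delta>) \<subseteq> D"
    using compact_subset_open_imp_ball_epsilon_subset[OF assms(1) open_D assms(2)] by blast
  have "uniformly_continuous_on (closure D) X'"
    using compact_uniformly_continuous[OF cont_X' compact_closure_D] .
  then obtain d1 where d1: "d1 > 0"
    "\<And>x y. \<lbrakk>x \<in> closure D; y \<in> closure D; dist y x < d1\<rbrakk> \<Longrightarrow> dist (X' y) (X' x) < e"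
    unfolding uniformly_continuous_on_def using \<open>e > 0\<close> by blast
  define d where "d = min \<delta> d1"
  show thesis
  proof (rule that)
    show "d > 0" using \<delta> d1 by (simp add: d_def)
    fix x y assume x: "x \<in> K" and y: "norm (y - x) < d"
    have ball: "ball x d \<subseteq> D" using \<delta> x by (force simp: d_def)
    have "norm ((X y - X' x y) - (X x - X' x x)) \<le> e * norm (y - x)"
    proof (rule differentiable_bound[of "ball x d" "\<lambda>y. X y - X' x y" "\<lambda>y v. (X' y - X' x) v"])
      fix s assume s: "s \<in> ball x d"
      show "((\<lambda>y. X y - X' x y) has_derivative (\<lambda>v. (X' s - X' x) v)) (at s within ball x d)"
        using s ball
        by (auto intro!: derivative_eq_intros has_derivative_at_withinI[OF deriv_X]
            simp: blinfun.diff_left)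
      have "dist (X' s) (X' x) < e"
      proof (rule d1(2))
        show "x \<in> closure D" "s \<in> closure D"
          using s ball x assms(2) closure_subset[of D] by blast+
        show "dist s x < d1" using s by (simp add: d_def dist_commute)
      qed
      then show "onorm (\<lambda>v. (X' s - X' x) v) \<le> e"
        by (simp add: dist_norm norm_blinfun.rep_eq)
    qed (use y \<open>d > 0\<close> in \<open>auto simp: dist_norm norm_minus_commute\<close>)
    then show "norm (X y - X x - X' x (y - x)) \<le> e * norm (y - x)"
      by (simp add: blinfun.diff_right algebra_simps)
  qed
qed

text \<open>Gronwall with \<open>\<epsilon> = 0\<close>, the compact set being the arc of
  \<open>z\<close> up to time \<open>t\<close>. The result covers forward times; periodicity will
  take care of negative ones.\<close>

lemma integral_curve_unique:
  assumes y: "integral_curve D X y" and z: "integral_curve D X z" and "y 0 = z 0" "0 \<le> t"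
  shows "y t = z t"
proof -
  have K: "compact (z ` {0..t})"
    by (intro compact_continuous_image integral_curve_continuous_on[OF z] compact_Icc)
  have KD: "z ` {0..t} \<subseteq> D" using integral_curveD(1)[OF z] by auto
  obtain L where L: "L > 0"
    "\<And>p q. \<lbrakk>p \<in> z ` {0..t}; q \<in> D\<rbrakk> \<Longrightarrow> norm (X q - X p) \<le> L * norm (q - p)"
    using lipschitz_from_compact[OF K KD] by blast
  have "norm (y t - z t) \<le> 0 * exp ((L + 1/2) * t)"
  proof (rule gronwall_norm_bound[of t "\<lambda>t. y t - z t" "\<lambda>t. X (y t) - X (z t)"])
    show "continuous_on {0..t} (\<lambda>t. y t - z t)"
      by (intro continuous_intros integral_curve_continuous_on[OF y] integral_curve_continuous_on[OF z])
    show "((\<lambda>t. y t - z t) has_vector_derivative X (y s) - X (z s)) (at s)" for s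
      by (intro has_vector_derivative_diff integral_curveD[OF y] integral_curveD[OF z])
  qed (use assms L integral_curveD(1)[OF y] in auto)
  then show ?thesis by simp
qed

text \<open>The shift by \<open>S\<close> starts at the same point and hence agrees with
  \<open>z\<close> at nonnegative times; adding a multiple of the known period \<open>P\<close>
  makes any \<open>t\<close> nonnegative. This identifies the minimal period with the first return
  time to the initial point.\<close>

lemma return_is_period:
  assumes z: "integral_curve D X z" and P: "P > 0" "\<And>t. z (t + P) = z t" and S: "z S = z 0"
  shows "z (t + S) = z t"
proof -
  obtain n :: nat where n: "- t < real n * P"
    using reals_Archimedean3[OF P(1)] by blast
  have "z (t + real n * P + S) = z (t + real n * P)"
    by (rule integral_curve_unique[OF integral_curve_shift[OF z] z]) (use S n in auto)
  moreover have "z (t + real n * P + S) = z (t + S)"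
    using periodic_mult[of z P "t + S" n] P(2) by (simp add: algebra_simps)
  ultimately show ?thesis using periodic_mult[of z P t n] P(2) by simp
qed

end

section \<open>One-parameter perturbations of a field: bounds, linearization, periods\<close>

locale C1_perturbation = X: C1_field D X X' + Y: C1_field D Y Y'
  for D :: "'a::euclidean_space set" and X X' Y Y'
begin

text \<open>Makes \<open>return_is_period\<close> available for each perturbed trajectory.\<close>

lemma C1_field_perturbed: "C1_field D (\<lambda>x. X x + l *\<^sub>R Y x) (\<lambda>x. X' x + l *\<^sub>R Y' x)"
proof
  show "((\<lambda>x. X x + l *\<^sub>R Y x) has_derivative blinfun_apply (X' x + l *\<^sub>R Y' x)) (at x)" if "x \<in> D" for x
    by (rule derivative_eq_intros X.deriv_X[OF that] Y.deriv_X[OF that] refl)+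
      (simp add: fun_eq_iff blinfun.add_left blinfun.scaleR_left)
qed (intro continuous_intros X.cont_X X.cont_X' Y.cont_X Y.cont_X' X.open_D X.bounded_D)+

text \<open>Gronwall with \<open>\<epsilon> = B * \<bar>l\<bar>\<close>, where \<open>B\<close>
  bounds \<open>Y\<close> on \<open>D\<close> and \<open>L\<close> is a Lipschitz constant of
  \<open>X\<close> relative to the arc of \<open>z\<close>. The constant \<open>C\<close> serves all
  \<open>l\<close> and all perturbed curves at once.\<close>

lemma perturbation_bound:
  assumes z: "integral_curve D X z"
  obtains C where "C > 0"
    "\<And>l y t. \<lbrakk>integral_curve D (\<lambda>x. X x + l *\<^sub>R Y x) y; y 0 = z 0; 0 \<le> t; t \<le> M\<rbrakk>
      \<Longrightarrow> norm (y t - z t) \<le> C * \<bar>l\<bar>"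
proof -
  have K: "compact (z ` {0..M})"
    by (intro compact_continuous_image integral_curve_continuous_on[OF z] compact_Icc)
  have KD: "z ` {0..M} \<subseteq> D" using integral_curveD(1)[OF z] by auto
  obtain L where L: "L > 0"
    "\<And>p q. \<lbrakk>p \<in> z ` {0..M}; q \<in> D\<rbrakk> \<Longrightarrow> norm (X q - X p) \<le> L * norm (q - p)"
    using X.lipschitz_from_compact[OF K KD] by blast
  obtain B where B: "B > 0" "\<And>x. x \<in> D \<Longrightarrow> norm (Y x) \<le> B"
    using Y.field_bound by blast
  define C where "C = B * exp ((L + 1/2) * M)"
  show thesis
  proof (rule that)
    show "C > 0" using B by (simp add: C_def)
    fix l t y assume y: "integral_curve D (\<lambda>x. X x + l *\<^sub>R Y x) y" "y 0 = z 0" and t: "0 \<le> t" "t \<le> M"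
    have "norm (y t - z t) \<le> (B * \<bar>l\<bar>) * exp ((L + 1/2) * t)"
    proof (rule gronwall_norm_bound[of M "\<lambda>t. y t - z t" "\<lambda>t. X (y t) + l *\<^sub>R Y (y t) - X (z t)"])
      show "continuous_on {0..M} (\<lambda>t. y t - z t)"
        by (intro continuous_intros integral_curve_continuous_on[OF y(1)] integral_curve_continuous_on[OF z])
      show "((\<lambda>t. y t - z t) has_vector_derivative X (y s) + l *\<^sub>R Y (y s) - X (z s)) (at s)" for s
        by (intro has_vector_derivative_diff integral_curveD[OF y(1)] integral_curveD[OF z])
      fix s assume s: "0 < s" "s < M"
      have "norm (X (y s) + l *\<^sub>R Y (y s) - X (z s)) = norm ((X (y s) - X (z s)) + l *\<^sub>R Y (y s))"
        by (simp add: algebra_simps)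
      also have "\<dots> \<le> norm (X (y s) - X (z s)) + norm (l *\<^sub>R Y (y s))"
        by (rule norm_triangle_ineq)
      also have "\<dots> \<le> L * norm (y s - z s) + B * \<bar>l\<bar>"
        using s B integral_curveD(1)[OF y(1)] by (intro add_mono L) (auto simp: mult.commute[of B] mult_left_mono)
      finally show "norm (X (y s) + l *\<^sub>R Y (y s) - X (z s)) \<le> L * norm (y s - z s) + B * \<bar>l\<bar>" .
    qed (use y t L B in auto)
    also have "\<dots> \<le> (B * \<bar>l\<bar>) * exp ((L + 1/2) * M)"
      using B L t by (intro mult_left_mono) auto
    finally show "norm (y t - z t) \<le> C * \<bar>l\<bar>" by (simp add: C_def algebra_simps)
  qed
qed

text \<open>Gronwall for \<open>y - z - l *\<^sub>R w\<close>, which starts at 0. Its derivative is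
  \<open>X' (z s)\<close> applied to itself, plus the Taylor remainder of \<open>X\<close> and
  \<open>l *\<^sub>R (Y (y s) - Y (z s))\<close>; both extra terms are of smaller order than
  \<open>l\<close> because \<open>y - z\<close> is of order \<open>l\<close>.\<close>

lemma linearization_error:
  assumes z: "integral_curve D X z"
    and w: "\<And>t. t \<in> {0..T} \<Longrightarrow> (w has_vector_derivative X' (z t) (w t) + Y (z t)) (at t within {0..T})"
    and w0: "w 0 = 0" and T: "0 \<le> T" and e: "e > 0"
  obtains d where "d > 0"
    "\<And>l y. \<lbrakk>\<bar>l\<bar> < d; integral_curve D (\<lambda>x. X x + l *\<^sub>R Y x) y; y 0 = z 0\<rbrakk>
      \<Longrightarrow> norm (y T - z T - l *\<^sub>R w T) \<le> e * \<bar>l\<bar>"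
proof -
  have K: "compact (z ` {0..T})"
    by (intro compact_continuous_image integral_curve_continuous_on[OF z] compact_Icc)
  have KD: "z ` {0..T} \<subseteq> D" using integral_curveD(1)[OF z] by auto
  obtain C where C: "C > 0"
    "\<And>l y t. \<lbrakk>integral_curve D (\<lambda>x. X x + l *\<^sub>R Y x) y; y 0 = z 0; 0 \<le> t; t \<le> T\<rbrakk>
      \<Longrightarrow> norm (y t - z t) \<le> C * \<bar>l\<bar>"
    using perturbation_bound[OF z] by blast
  obtain L where L: "L > 0"
    "\<And>p q. \<lbrakk>p \<in> z ` {0..T}; q \<in> D\<rbrakk> \<Longrightarrow> norm (Y q - Y p) \<le> L * norm (q - p)"
    using Y.lipschitz_from_compact[OF K KD] by blast
  obtain B where B: "B > 0" "\<And>x. x \<in> D \<Longrightarrow> norm (X' x) \<le> B"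
    using X.derivative_bound by blast
  define E where "E = exp ((B + 1/2) * T)"
  \<comment> \<open>Each of the two extra terms will be at most
    \<open>e1 * C * \<bar>l\<bar>\<close>, and Gronwall multiplies their sum by at most
    \<open>E\<close>; the total is \<open>e * \<bar>l\<bar>\<close>.\<close>
  define e1 where "e1 = e / (2 * C * E)"
  have "E > 0" by (simp add: E_def)
  have "e1 > 0" using e C \<open>E > 0\<close> by (simp add: e1_def)
  obtain d1 where d1: "d1 > 0"
    "\<And>x y. \<lbrakk>x \<in> z ` {0..T}; norm (y - x) < d1\<rbrakk> \<Longrightarrow> norm (X y - X x - X' x (y - x)) \<le> e1 * norm (y - x)"
    using X.uniform_linearization[OF K KD \<open>e1 > 0\<close>] by blast
  \<comment> \<open>The first entry brings \<open>y\<close> within the range \<open>d1\<close> of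
    the linearization of \<open>X\<close>, the second makes the Lipschitz bound for \<open>Y\<close>
    contribute at most \<open>e1\<close>.\<close>
  define d where "d = min (d1 / C) (e1 / L)"
  show thesis
  proof (rule that)
    show "d > 0" using d1 C \<open>e1 > 0\<close> L by (simp add: d_def)
    fix l y assume l: "\<bar>l\<bar> < d" and y: "integral_curve D (\<lambda>x. X x + l *\<^sub>R Y x) y" "y 0 = z 0"
    have l1: "C * \<bar>l\<bar> < d1" using l C by (simp add: d_def field_simps)
    have l2: "L * \<bar>l\<bar> \<le> e1" using l L by (simp add: d_def field_simps)
    have "norm (y T - z T - l *\<^sub>R w T) \<le> (2 * e1 * C * \<bar>l\<bar>) * exp ((B + 1/2) * T)"
    proof (rule gronwall_norm_bound[of T "\<lambda>t. y t - z t - l *\<^sub>R w t"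
          "\<lambda>t. X (y t) + l *\<^sub>R Y (y t) - X (z t) - l *\<^sub>R (X' (z t) (w t) + Y (z t))"])
      have "continuous_on {0..T} w"
        unfolding continuous_on_eq_continuous_within
        using w has_vector_derivative_continuous by blast
      then show "continuous_on {0..T} (\<lambda>t. y t - z t - l *\<^sub>R w t)"
        by (intro continuous_intros integral_curve_continuous_on[OF y(1)] integral_curve_continuous_on[OF z])
      fix s assume s: "0 < s" "s < T"
      have "(w has_vector_derivative X' (z s) (w s) + Y (z s)) (at s)"
        using w[of s] s at_within_Icc_at[of 0 s T] by simp
      then show "((\<lambda>t. y t - z t - l *\<^sub>R w t) has_vector_derivative
          X (y s) + l *\<^sub>R Y (y s) - X (z s) - l *\<^sub>R (X' (z s) (w s) + Y (z s))) (at s)"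
        using integral_curveD(2)[OF y(1), of s] integral_curveD(2)[OF z, of s]
        by (auto intro!: derivative_eq_intros)
      have zs: "z s \<in> z ` {0..T}" using s by auto
      have yz: "norm (y s - z s) \<le> C * \<bar>l\<bar>" using C(2)[OF y] s by auto
      have b1: "norm (X (y s) - X (z s) - X' (z s) (y s - z s)) \<le> e1 * C * \<bar>l\<bar>"
      proof -
        have "norm (X (y s) - X (z s) - X' (z s) (y s - z s)) \<le> e1 * norm (y s - z s)"
          using yz l1 by (intro d1(2) zs) auto
        also have "\<dots> \<le> e1 * (C * \<bar>l\<bar>)" using \<open>e1 > 0\<close> yz by (intro mult_left_mono) auto
        finally show ?thesis by (simp add: algebra_simps)
      qed
      have b2: "norm (l *\<^sub>R (Y (y s) - Y (z s))) \<le> e1 * C * \<bar>l\<bar>"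
      proof -
        have "norm (Y (y s) - Y (z s)) \<le> L * norm (y s - z s)"
          by (intro L zs integral_curveD(1)[OF y(1)])
        also have "\<dots> \<le> L * (C * \<bar>l\<bar>)" using L yz by (intro mult_left_mono) auto
        also have "\<dots> = (L * \<bar>l\<bar>) * C" by simp
        also have "\<dots> \<le> e1 * C" using l2 C by (intro mult_right_mono) auto
        finally have "\<bar>l\<bar> * norm (Y (y s) - Y (z s)) \<le> \<bar>l\<bar> * (e1 * C)" by (intro mult_left_mono) auto
        then show ?thesis by (simp add: mult_ac)
      qed
      have b3: "norm (X' (z s) (y s - z s - l *\<^sub>R w s)) \<le> B * norm (y s - z s - l *\<^sub>R w s)"
        using norm_blinfun[of "X' (z s)" "y s - z s - l *\<^sub>R w s"] B(2)[OF integral_curveD(1)[OF z, of s]]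
        by (meson mult_right_mono norm_ge_zero order_trans)
      have "X (y s) + l *\<^sub>R Y (y s) - X (z s) - l *\<^sub>R (X' (z s) (w s) + Y (z s)) =
         X' (z s) (y s - z s - l *\<^sub>R w s) + ((X (y s) - X (z s) - X' (z s) (y s - z s))
           + l *\<^sub>R (Y (y s) - Y (z s)))"
        by (simp add: blinfun.diff_right blinfun.add_right blinfun.scaleR_right algebra_simps)
      then show "norm (X (y s) + l *\<^sub>R Y (y s) - X (z s) - l *\<^sub>R (X' (z s) (w s) + Y (z s)))
         \<le> B * norm (y s - z s - l *\<^sub>R w s) + 2 * e1 * C * \<bar>l\<bar>"
        using norm_add_rule_thm[OF b3 norm_add_rule_thm[OF b1 b2]] by (simp add: algebra_simps)
    qed (use y w0 B C \<open>e1 > 0\<close> T in auto)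
    also have "\<dots> = e * \<bar>l\<bar>"
      using \<open>E > 0\<close> C by (simp add: e1_def flip: E_def)
    finally show "norm (y T - z T - l *\<^sub>R w T) \<le> e * \<bar>l\<bar>" .
  qed
qed

text \<open>Continuity keeps the unperturbed product above half of its positive value at
  \<open>x0\<close>, and boundedness of \<open>Y\<close> keeps the perturbation below that half. The
  ball is chosen before \<open>l\<close>. The filter is \<open>nhds 0\<close>, not
  \<open>at 0\<close>, so that \<open>l = 0\<close> can be extracted as well.\<close>

lemma transversal_nearby:
  assumes "x0 \<in> D" and "X x0 \<bullet> e \<noteq> 0"
  obtains \<rho> where "\<rho> > 0" "ball x0 \<rho> \<subseteq> D"
    "\<forall>\<^sub>F l in nhds 0. \<forall>x\<in>ball x0 \<rho>. (X x0 \<bullet> e) * ((X x + l *\<^sub>R Y x) \<bullet> e) > 0"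
proof -
  define a where "a = X x0 \<bullet> e"
  have "a * a > 0" using assms(2) by (auto simp: a_def zero_less_mult_iff)
  have "isCont X x0"
    using X.deriv_X[OF assms(1)] by (rule has_derivative_continuous)
  then have "isCont (\<lambda>x. a * (X x \<bullet> e)) x0"
    by (intro continuous_intros)
  then have "((\<lambda>x. a * (X x \<bullet> e)) \<longlongrightarrow> a * a) (nhds x0)"
    using tendsto_at_iff_tendsto_nhds[of "\<lambda>x. a * (X x \<bullet> e)" x0] by (simp add: isCont_def a_def)
  then have "\<forall>\<^sub>F x in nhds x0. a * (X x \<bullet> e) > a * a / 2"
    by (rule order_tendstoD(1)) (use \<open>a * a > 0\<close> in simp)
  moreover have "\<forall>\<^sub>F x in nhds x0. x \<in> D"
    using X.open_D assms(1) by (rule eventually_nhds_in_open)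
  ultimately have "\<forall>\<^sub>F x in nhds x0. a * (X x \<bullet> e) > a * a / 2 \<and> x \<in> D"
    by (rule eventually_conj)
  then obtain \<rho> where \<rho>: "\<rho> > 0" "\<And>x. dist x x0 < \<rho> \<Longrightarrow> a * (X x \<bullet> e) > a * a / 2 \<and> x \<in> D"
    unfolding eventually_nhds_metric by blast
  obtain B where B: "B > 0" "\<And>x. x \<in> D \<Longrightarrow> norm (Y x) \<le> B"
    using Y.field_bound by blast
  have "((\<lambda>l. \<bar>l\<bar> * (\<bar>a\<bar> * (B * norm e))) \<longlongrightarrow> 0) (nhds 0)"
    by (rule tendsto_eq_intros filterlim_ident | simp)+
  then have "\<forall>\<^sub>F l in nhds 0. \<bar>l\<bar> * (\<bar>a\<bar> * (B * norm e)) < a * a / 2"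
    by (rule order_tendstoD(2)) (use \<open>a * a > 0\<close> in simp)
  then have "\<forall>\<^sub>F l in nhds 0. \<forall>x\<in>ball x0 \<rho>. a * ((X x + l *\<^sub>R Y x) \<bullet> e) > 0"
  proof eventually_elim
    case (elim l)
    show ?case
    proof
      fix x assume "x \<in> ball x0 \<rho>"
      then have x: "a * (X x \<bullet> e) > a * a / 2" "x \<in> D" using \<rho>(2)[of x] by (auto simp: dist_commute)
      have "\<bar>Y x \<bullet> e\<bar> \<le> B * norm e"
        using Cauchy_Schwarz_ineq2[of "Y x" e] B(2)[OF x(2)]
        by (meson mult_right_mono norm_ge_zero order_trans)
      then have "\<bar>l * (a * (Y x \<bullet> e))\<bar> \<le> \<bar>l\<bar> * (\<bar>a\<bar> * (B * norm e))"
        unfolding abs_mult by (intro mult_left_mono) auto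
      then show "a * ((X x + l *\<^sub>R Y x) \<bullet> e) > 0"
        using x(1) elim by (simp add: inner_add_left algebra_simps)
    qed
  qed
  then show thesis
    using \<rho> by (intro that[of \<rho>]) (auto simp: a_def dist_commute)
qed

text \<open>The hypothesis \<open>return\<close> excludes that a perturbed trajectory crosses the transversal
  near \<open>z 0\<close> without closing up; for Hamiltonian systems it follows from conservation of energy.\<close>

lemma period_tendsto:
  assumes z: "integral_curve D X z" and T: "is_minimal_period z T"
    and zl: "\<forall>\<^sub>F l in at 0. integral_curve D (\<lambda>x. X x + l *\<^sub>R Y x) (zl l) \<and> zl l 0 = z 0 \<and>
      is_minimal_period (zl l) (Tl l)"
    and transversal: "X (z 0) \<bullet> e \<noteq> 0"
    and \<delta>: "\<delta> > 0"
    and return: "\<forall>\<^sub>F l in at 0. \<forall>t. zl l t \<in> ball (z 0) \<delta> \<and> zl l t \<bullet> e = z 0 \<bullet> e \<longrightarrow> zl l t = z 0"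
  shows "(Tl \<longlongrightarrow> T) (at 0)"
proof (rule tendstoI)
  fix \<eta> :: real assume "\<eta> > 0"
  define a where "a = X (z 0) \<bullet> e"
  have "a \<noteq> 0" using transversal by (simp add: a_def)
  have "T > 0" and per: "\<And>t. z (t + T) = z t"
    and min: "\<And>S. \<lbrakk>0 < S; S < T\<rbrakk> \<Longrightarrow> \<not> (\<forall>t. z (t + S) = z t)"
    using T by (auto simp: is_minimal_period_def)
  obtain \<rho>0 where \<rho>0: "\<rho>0 > 0" "ball (z 0) \<rho>0 \<subseteq> D"
    "\<forall>\<^sub>F l in nhds 0. \<forall>x\<in>ball (z 0) \<rho>0. a * ((X x + l *\<^sub>R Y x) \<bullet> e) > 0"
    using transversal_nearby[OF integral_curveD(1)[OF z] transversal] unfolding a_def by blast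
  \<comment> \<open>In this ball both the transversality and the hypothesis \<open>return\<close>
    are available.\<close>
  define \<rho> where "\<rho> = min \<rho>0 \<delta>"
  have "\<rho> > 0" using \<rho>0 \<delta> by (simp add: \<rho>_def)
  have pos0: "a * (X x \<bullet> e) > 0" if "x \<in> ball (z 0) \<rho>" for x
    using eventually_nhds_x_imp_x[OF \<rho>0(3)] that by (auto simp: \<rho>_def)
  have "isCont z 0"
    using integral_curveD(2)[OF z] has_vector_derivative_continuous by blast
  then obtain \<tau>0 where \<tau>0: "\<tau>0 > 0" "\<And>t. \<bar>t\<bar> < \<tau>0 \<Longrightarrow> dist (z t) (z 0) < \<rho> / 2"
    unfolding continuous_at_eps_delta using \<open>\<rho> > 0\<close>
    by (metis dist_real_def diff_zero half_gt_zero)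
  \<comment> \<open>The window half-width: \<open>\<tau>0\<close> keeps \<open>z\<close> near
    \<open>z 0\<close> in the windows around 0 and \<open>T\<close>, \<open>T / 3\<close> keeps
    these windows disjoint, and \<open>\<eta> / 2\<close> turns the final bound
    \<open>\<tau>\<close> into a strict one by \<open>\<eta>\<close>.\<close>
  define \<tau> where "\<tau> = min (\<tau>0 / 2) (min (T / 3) (\<eta> / 2))"
  have \<tau>: "\<tau> > 0" "\<tau> < \<tau>0" "\<tau> \<le> T / 3" "\<tau> \<le> \<eta> / 2"
    using \<tau>0 \<open>T > 0\<close> \<open>\<eta> > 0\<close> by (auto simp: \<tau>_def)
  have zT: "dist (z t) (z 0) < \<rho> / 2" if "\<bar>t - T\<bar> \<le> \<tau>" for t
    using \<tau>0(2)[of "t - T"] per[of "t - T"] that \<tau> by simp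
  have z0: "dist (z t) (z 0) < \<rho> / 2" if "\<bar>t\<bar> \<le> \<tau>" for t
    using \<tau>0(2)[of t] that \<tau> by simp
  have zT_eq: "z T = z 0" using per[of 0] by simp
  have inball: "z t \<in> ball (z 0) \<rho>" if "\<bar>t - T\<bar> \<le> \<tau>" for t
    using zT[OF that] \<open>\<rho> > 0\<close> by (simp add: dist_commute)
  have right: "a * (z T \<bullet> e) < a * (z (T + \<tau>) \<bullet> e)"
    using \<tau> by (intro integral_curve_inner_increasing[OF z] pos0 inball) auto
  have left: "a * (z (T - \<tau>) \<bullet> e) < a * (z T \<bullet> e)"
    using \<tau> by (intro integral_curve_inner_increasing[OF z] pos0 inball) auto
  \<comment> \<open>The margin by which \<open>z\<close> lies on either side of the transversal at
    the ends of the window around \<open>T\<close>. A perturbation smaller than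
    \<open>\<kappa>\<close> still changes sides, which the intermediate value theorem exploits
    below.\<close>
  define \<kappa> where "\<kappa> = min (a * (z (T + \<tau>) \<bullet> e) - a * (z T \<bullet> e)) (a * (z T \<bullet> e) - a * (z (T - \<tau>) \<bullet> e))"
  have "\<kappa> > 0" using left right by (simp add: \<kappa>_def)
  have no_return: "z t \<noteq> z 0" if "0 < t" "t < T" for t
    using X.return_is_period[OF z \<open>T > 0\<close> per] min[OF that] by blast
  \<comment> \<open>Between the two windows the distance to the initial point attains its minimum,
    which is positive by \<open>no_return\<close>.\<close>
  obtain m where m: "m > 0" "\<And>t. \<lbrakk>\<tau> \<le> t; t \<le> T - \<tau>\<rbrakk> \<Longrightarrow> m \<le> dist (z t) (z 0)"
  proof -
    have "\<exists>x\<in>{\<tau>..T - \<tau>}. \<forall>y\<in>{\<tau>..T - \<tau>}. dist (z x) (z 0) \<le> dist (z y) (z 0)"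
      using \<tau> \<open>T > 0\<close>
      by (intro continuous_attains_inf continuous_intros integral_curve_continuous_on[OF z]) auto
    then obtain x where x: "x \<in> {\<tau>..T - \<tau>}" "\<forall>y\<in>{\<tau>..T - \<tau>}. dist (z x) (z 0) \<le> dist (z y) (z 0)"
      by blast
    then have "dist (z x) (z 0) > 0" using no_return[of x] \<tau> by auto
    with x show thesis by (intro that[of "dist (z x) (z 0)"]) auto
  qed
  obtain C where C: "C > 0"
    "\<And>l y t. \<lbrakk>integral_curve D (\<lambda>x. X x + l *\<^sub>R Y x) y; y 0 = z 0; 0 \<le> t; t \<le> T + \<tau>\<rbrakk>
      \<Longrightarrow> norm (y t - z t) \<le> C * \<bar>l\<bar>"
    using perturbation_bound[OF z] by blast
  have small: "\<forall>\<^sub>F l in at 0. C * \<bar>l\<bar> * c < b" if "b > 0" for b c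
    by (rule order_tendstoD(2)[where y = 0]) (rule tendsto_eq_intros | use that in simp)+
  have "\<forall>\<^sub>F l in at 0. \<forall>x\<in>ball (z 0) \<rho>0. a * ((X x + l *\<^sub>R Y x) \<bullet> e) > 0"
    using \<rho>0(3) by (simp add: eventually_at_filter eventually_mono)
  with zl return small[OF half_gt_zero[OF \<open>\<rho> > 0\<close>], of 1] small[OF m(1), of 1]
    small[OF \<open>\<kappa> > 0\<close>, of "\<bar>a\<bar> * norm e"]
  show "\<forall>\<^sub>F l in at 0. dist (Tl l) T < \<eta>"
  proof eventually_elim
    case (elim l)
    then have y: "integral_curve D (\<lambda>x. X x + l *\<^sub>R Y x) (zl l)" and y0: "zl l 0 = z 0"
      and P: "Tl l > 0" "\<And>t. zl l (t + Tl l) = zl l t"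
      and Pmin: "\<And>S. \<lbrakk>0 < S; S < Tl l\<rbrakk> \<Longrightarrow> \<not> (\<forall>t. zl l (t + S) = zl l t)"
      by (auto simp: is_minimal_period_def)
    note close = C(2)[OF y y0]
    have near: "zl l t \<in> ball (z 0) \<rho>" if "0 \<le> t" "t \<le> T + \<tau>" "dist (z t) (z 0) < \<rho> / 2" for t
    proof -
      have "dist (zl l t) (z t) < \<rho> / 2"
        using close[OF that(1,2)] elim by (simp add: dist_norm)
      then show ?thesis using dist_triangle_half_l[of "zl l t" "z t" \<rho> "z 0"] that(3)
        by (simp add: dist_commute)
    qed
    have pos: "a * ((X x + l *\<^sub>R Y x) \<bullet> e) > 0" if "x \<in> ball (z 0) \<rho>" for x
      using elim that by (auto simp: \<rho>_def)
    have diff: "\<bar>a * (zl l t \<bullet> e) - a * (z t \<bullet> e)\<bar> < \<kappa>" if "0 \<le> t" "t \<le> T + \<tau>" for t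
    proof -
      have "\<bar>a * (zl l t \<bullet> e) - a * (z t \<bullet> e)\<bar> = \<bar>a\<bar> * \<bar>(zl l t - z t) \<bullet> e\<bar>"
        by (simp add: abs_mult inner_diff_left flip: right_diff_distrib)
      also have "\<dots> \<le> \<bar>a\<bar> * (norm (zl l t - z t) * norm e)"
        by (intro mult_left_mono Cauchy_Schwarz_ineq2) auto
      also have "\<dots> \<le> \<bar>a\<bar> * (C * \<bar>l\<bar> * norm e)"
        by (intro mult_left_mono mult_right_mono close that) auto
      also have "\<dots> < \<kappa>" using elim by (simp add: mult_ac)
      finally show ?thesis .
    qed
    have "\<exists>s\<ge>T - \<tau>. s \<le> T + \<tau> \<and> a * (zl l s \<bullet> e) = a * (z T \<bullet> e)"
    proof (rule IVT')
      show "a * (zl l (T - \<tau>) \<bullet> e) \<le> a * (z T \<bullet> e)"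
        using diff[of "T - \<tau>"] \<tau> \<open>T > 0\<close> by (auto simp: \<kappa>_def)
      show "a * (z T \<bullet> e) \<le> a * (zl l (T + \<tau>) \<bullet> e)"
        using diff[of "T + \<tau>"] \<tau> \<open>T > 0\<close> by (auto simp: \<kappa>_def)
      show "continuous_on {T - \<tau>..T + \<tau>} (\<lambda>s. a * (zl l s \<bullet> e))"
        by (intro continuous_intros integral_curve_continuous_on[OF y])
    qed (use \<tau> in auto)
    then obtain s where s: "T - \<tau> \<le> s" "s \<le> T + \<tau>" "zl l s \<bullet> e = z 0 \<bullet> e"
      using \<open>a \<noteq> 0\<close> zT_eq by auto
    have "zl l s \<in> ball (z 0) \<rho>"
      using s \<tau> \<open>T > 0\<close> by (intro near zT) auto
    then have "zl l s = zl l 0"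
      using elim s(3) y0 by (auto simp: \<rho>_def)
    then have "\<forall>t. zl l (t + s) = zl l t"
      using C1_field.return_is_period[OF C1_field_perturbed y P] by blast
    then have upper: "Tl l \<le> s"
      using Pmin[of s] s \<tau> \<open>T > 0\<close> by force
    have lower: "T - \<tau> < Tl l"
    proof (rule ccontr)
      assume "\<not> T - \<tau> < Tl l"
      then have le: "Tl l \<le> T - \<tau>" by simp
      have ret: "zl l (Tl l) = z 0" using P(2)[of 0] y0 by simp
      show False
      \<comment> \<open>Up to time \<open>\<tau>\<close> the perturbed curve moves strictly
        monotonically along \<open>e\<close> and cannot come back; from \<open>\<tau>\<close> to
        \<open>T - \<tau>\<close> the distance \<open>m\<close> exceeds the perturbation.\<close>
      proof (cases "Tl l \<le> \<tau>")
        case True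
        have "a * (zl l 0 \<bullet> e) < a * (zl l (Tl l) \<bullet> e)"
          using True le \<tau> \<open>T > 0\<close>
          by (intro integral_curve_inner_increasing[OF y] P pos near z0) auto
        then show False using ret y0 by simp
      next
        case False
        then have "m \<le> dist (z (Tl l)) (z 0)" using le by (intro m) auto
        also have "\<dots> \<le> C * \<bar>l\<bar>"
          using close[of "Tl l"] P le \<tau> ret by (simp add: dist_norm norm_minus_commute)
        finally show False using elim by simp
      qed
    qed
    show ?case using upper lower s \<tau> \<open>\<eta> > 0\<close> by (auto simp: dist_real_def)
  qed
qed

text \<open>The quotient equals minus the component along \<open>e\<close> of
  \<open>(zl l T - z T) /\<^sub>R l\<close>, divided by the speed along \<open>e\<close> at an
  intermediate time. The numerator converges by \<open>linearization_error\<close>; the denominator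
  converges because the intermediate times are squeezed between \<open>T\<close> and
  \<open>Tl l\<close>.\<close>

lemma period_derivative:
  assumes z: "integral_curve D X z" and T: "is_minimal_period z T"
    and zl: "\<forall>\<^sub>F l in at 0. integral_curve D (\<lambda>x. X x + l *\<^sub>R Y x) (zl l) \<and> zl l 0 = z 0 \<and>
      is_minimal_period (zl l) (Tl l)"
    and w: "\<And>t. t \<in> {0..T} \<Longrightarrow> (w has_vector_derivative X' (z t) (w t) + Y (z t)) (at t within {0..T})"
    and w0: "w 0 = 0"
    and transversal: "X (z 0) \<bullet> e \<noteq> 0"
    and \<delta>: "\<delta> > 0"
    and return: "\<forall>\<^sub>F l in at 0. \<forall>t. zl l t \<in> ball (z 0) \<delta> \<and> zl l t \<bullet> e = z 0 \<bullet> e \<longrightarrow> zl l t = z 0"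
  shows "((\<lambda>l. (Tl l - T) / l) \<longlongrightarrow> - (w T \<bullet> e) / (X (z 0) \<bullet> e)) (at 0)"
proof -
  let ?V = "\<lambda>l x. X x + l *\<^sub>R Y x"
  have "T > 0" and zT: "z T = z 0"
    using T unfolding is_minimal_period_def by (metis, metis add_0)
  have Tl: "(Tl \<longlongrightarrow> T) (at 0)"
    by (rule period_tendsto[OF z T zl transversal \<delta> return])
  have lin: "((\<lambda>l. (zl l T - z T) /\<^sub>R l) \<longlongrightarrow> w T) (at 0)"
  proof (rule tendstoI)
    fix \<epsilon> :: real assume "\<epsilon> > 0"
    obtain d where d: "d > 0"
      "\<And>l y. \<lbrakk>\<bar>l\<bar> < d; integral_curve D (?V l) y; y 0 = z 0\<rbrakk>
        \<Longrightarrow> norm (y T - z T - l *\<^sub>R w T) \<le> \<epsilon> / 2 * \<bar>l\<bar>"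
      using linearization_error[OF z w w0 less_imp_le[OF \<open>T > 0\<close>] half_gt_zero[OF \<open>\<epsilon> > 0\<close>]] by blast
    have "\<forall>\<^sub>F l in at 0. \<bar>l\<bar> < d \<and> l \<noteq> 0"
      unfolding eventually_at using d(1) by (auto simp: dist_real_def)
    with zl show "\<forall>\<^sub>F l in at 0. dist ((zl l T - z T) /\<^sub>R l) (w T) < \<epsilon>"
    proof eventually_elim
      case (elim l)
      have "(zl l T - z T) /\<^sub>R l - w T = (zl l T - z T - l *\<^sub>R w T) /\<^sub>R l"
        using elim by (simp add: algebra_simps)
      then have "dist ((zl l T - z T) /\<^sub>R l) (w T) = norm (zl l T - z T - l *\<^sub>R w T) / \<bar>l\<bar>"
        by (simp add: dist_norm divide_inverse)
      also have "\<dots> \<le> \<epsilon> / 2"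
        using d(2)[of l "zl l"] elim by (simp add: pos_divide_le_eq)
      finally show ?case using \<open>\<epsilon> > 0\<close> by simp
    qed
  qed
  have "\<forall>\<^sub>F l in at 0. \<exists>\<xi>. \<bar>\<xi> - T\<bar> \<le> \<bar>Tl l - T\<bar> \<and>
      (zl l (Tl l) - zl l T) \<bullet> e = (Tl l - T) * (?V l (zl l \<xi>) \<bullet> e)"
    using zl
  proof eventually_elim
    case (elim l)
    have der: "((\<lambda>s. zl l s \<bullet> e) has_real_derivative ?V l (zl l s) \<bullet> e) (at s)" for s
      using elim integral_curveD(2)[of D "?V l" "zl l" s]
      unfolding has_vector_derivative_def has_field_derivative_def
      by (auto intro!: derivative_eq_intros simp: fun_eq_iff inner_add_left algebra_simps)
    consider "Tl l = T" | "Tl l < T" | "T < Tl l" by linarith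
    then show ?case
    proof cases
      case 1
      then show ?thesis by (intro exI[of _ T]) simp
    next
      case 2
      obtain \<xi> where "Tl l < \<xi>" "\<xi> < T"
        "zl l T \<bullet> e - zl l (Tl l) \<bullet> e = (T - Tl l) * (?V l (zl l \<xi>) \<bullet> e)"
        using MVT2[OF 2 der] by blast
      then show ?thesis by (intro exI[of _ \<xi>]) (auto simp: inner_diff_left algebra_simps)
    next
      case 3
      obtain \<xi> where "T < \<xi>" "\<xi> < Tl l"
        "zl l (Tl l) \<bullet> e - zl l T \<bullet> e = (Tl l - T) * (?V l (zl l \<xi>) \<bullet> e)"
        using MVT2[OF 3 der] by blast
      then show ?thesis by (intro exI[of _ \<xi>]) (auto simp: inner_diff_left)
    qed
  qed
  \<comment> \<open>Choosing the intermediate times as a function of \<open>l\<close> allows taking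
    their limit.\<close>
  then obtain \<xi> where \<xi>: "\<forall>\<^sub>F l in at 0. \<bar>\<xi> l - T\<bar> \<le> \<bar>Tl l - T\<bar> \<and>
      (zl l (Tl l) - zl l T) \<bullet> e = (Tl l - T) * (?V l (zl l (\<xi> l)) \<bullet> e)"
    unfolding eventually_ex by blast
  have \<xi>_lim: "(\<xi> \<longlongrightarrow> T) (at 0)"
  proof (rule Lim_transform2[OF Tl])
    have Tl0: "((\<lambda>l. Tl l - T) \<longlongrightarrow> 0) (at 0)"
      using Tl by (simp add: LIM_zero)
    have "\<forall>\<^sub>F l in at 0. norm (\<xi> l - T) \<le> \<bar>Tl l - T\<bar>"
      using \<xi> by eventually_elim simp
    then have "((\<lambda>l. \<xi> l - T) \<longlongrightarrow> 0) (at 0)"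
      using tendsto_rabs_zero[OF Tl0] by (rule Lim_null_comparison)
    from tendsto_diff[OF Tl0 this] show "((\<lambda>l. Tl l - \<xi> l) \<longlongrightarrow> 0) (at 0)"
      by simp
  qed
  \<comment> \<open>The horizon is \<open>2 * T\<close> because \<open>\<xi> l\<close> may exceed
    \<open>T\<close>; it lies eventually between 0 and \<open>2 * T\<close>.\<close>
  obtain C where C: "C > 0"
    "\<And>l y t. \<lbrakk>integral_curve D (?V l) y; y 0 = z 0; 0 \<le> t; t \<le> 2 * T\<rbrakk>
      \<Longrightarrow> norm (y t - z t) \<le> C * \<bar>l\<bar>"
    using perturbation_bound[OF z] by blast
  have "\<forall>\<^sub>F l in at 0. 0 < \<xi> l" "\<forall>\<^sub>F l in at 0. \<xi> l < 2 * T"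
    using order_tendstoD[OF \<xi>_lim] \<open>T > 0\<close> by auto
  with zl have "\<forall>\<^sub>F l in at 0. norm (zl l (\<xi> l) - z (\<xi> l)) \<le> C * \<bar>l\<bar>"
    by eventually_elim (auto intro!: C)
  then have "((\<lambda>l. zl l (\<xi> l) - z (\<xi> l)) \<longlongrightarrow> 0) (at 0)"
    by (rule Lim_null_comparison) (rule tendsto_eq_intros | simp)+
  moreover have "((\<lambda>l. z (\<xi> l)) \<longlongrightarrow> z T) (at 0)"
    using integral_curveD(2)[OF z] has_vector_derivative_continuous \<xi>_lim isCont_tendsto_compose by blast
  ultimately have zl_lim: "((\<lambda>l. zl l (\<xi> l)) \<longlongrightarrow> z 0) (at 0)"
    using tendsto_add[of "\<lambda>l. zl l (\<xi> l) - z (\<xi> l)" 0 "at 0" "\<lambda>l. z (\<xi> l)" "z T"] zT by simp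
  have "isCont X (z 0)" "isCont Y (z 0)"
    using X.deriv_X Y.deriv_X integral_curveD(1)[OF z] has_derivative_continuous by blast+
  then have V_lim: "((\<lambda>l. ?V l (zl l (\<xi> l)) \<bullet> e) \<longlongrightarrow> X (z 0) \<bullet> e) (at 0)"
    by (auto intro!: tendsto_eq_intros isCont_tendsto_compose[OF _ zl_lim])
  have "((\<lambda>l. - (((zl l T - z T) /\<^sub>R l) \<bullet> e) / (?V l (zl l (\<xi> l)) \<bullet> e))
      \<longlongrightarrow> - (w T \<bullet> e) / (X (z 0) \<bullet> e)) (at 0)"
    by (intro tendsto_intros lin V_lim transversal)
  moreover have "\<forall>\<^sub>F l in at 0. ?V l (zl l (\<xi> l)) \<bullet> e \<noteq> 0"
    using V_lim transversal by (rule tendsto_imp_eventually_ne)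
  then have "\<forall>\<^sub>F l in at 0. - (((zl l T - z T) /\<^sub>R l) \<bullet> e) / (?V l (zl l (\<xi> l)) \<bullet> e) = (Tl l - T) / l"
    using zl \<xi>
  proof eventually_elim
    case (elim l)
    have "zl l (Tl l) = z T"
      using elim zT unfolding is_minimal_period_def by (metis add_0)
    then have "- ((zl l T - z T) \<bullet> e) = (Tl l - T) * (?V l (zl l (\<xi> l)) \<bullet> e)"
      using elim by (simp add: inner_diff_left)
    then show ?case
      using elim(1) by (simp add: divide_inverse flip: mult_minus_right)
  qed
  ultimately show ?thesis by (rule Lim_transform_eventually)
qed

end

section \<open>Planar Hamiltonian fields and conservation of energy\<close>

text \<open>The counterclockwise quarter turn: it takes the gradient of \<open>h\<close> to the
  Hamiltonian field of \<open>h\<close> in the sign convention of the system.\<close>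

definition rot :: "real^2 \<Rightarrow> real^2" where
  "rot v = vector [- v $ 2, v $ 1]"

lemma rot_component [simp]: "rot v $ 1 = - v $ 2" "rot v $ 2 = v $ 1"
  by (simp_all add: rot_def)

lemma rot_add: "rot (u + v) = rot u + rot v"
  by (simp add: vec_eq_iff forall_2)

lemma rot_scaleR: "rot (c *\<^sub>R v) = c *\<^sub>R rot v"
  by (simp add: vec_eq_iff forall_2)

lemma bounded_linear_rot: "bounded_linear rot"
  by (auto intro!: linearI simp: rot_add rot_scaleR simp flip: linear_conv_bounded_linear)

text \<open>The value of \<open>deriv\<close> is informative only where a derivative exists; the
  chain rule along the coordinate line provides one.\<close>

lemma pd_eq_gradient:
  assumes "GDERIV g x :> G"
  shows "pd i g x = G $ i"
proof -
  have g: "(g has_derivative (\<lambda>h. h \<bullet> G)) (at (x + 0 *\<^sub>R axis i 1))"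
    using assms by (simp add: gderiv_def)
  have "((\<lambda>s. x + s *\<^sub>R axis i 1) has_derivative (\<lambda>s. s *\<^sub>R axis i 1)) (at (0::real))"
    by (auto intro!: derivative_eq_intros)
  from has_derivative_compose[OF this g]
  have "((\<lambda>s. g (x + s *\<^sub>R axis i 1)) has_real_derivative G $ i) (at 0)"
    by (simp add: has_field_derivative_def inner_axis' mult_commute_abs)
  then show ?thesis
    unfolding pd_def by (rule DERIV_imp_deriv)
qed

text \<open>Row \<open>i\<close> of the Hessian is the gradient of \<open>pd i g\<close>. As
  \<open>pd i g\<close> is known to agree with component \<open>i\<close> of \<open>G\<close> only
  on \<open>D\<close>, differentiability is transferred through the open set. This matches the
  coefficients of the linearized system with the derivative of the Hamiltonian field.\<close>

lemma grad_pd_inner: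
  fixes G :: "real^2 \<Rightarrow> real^2" and A :: "real^2^2"
  assumes "open D" "x \<in> D" and G: "\<And>y. y \<in> D \<Longrightarrow> GDERIV g y :> G y"
    and H: "(G has_derivative (\<lambda>h. A *v h)) (at x)"
  shows "grad (pd i g) x \<bullet> v = (A *v v) $ i"
proof -
  have "((\<lambda>y. G y $ i) has_derivative (\<lambda>h. (A *v h) $ i)) (at x)"
    by (rule bounded_linear.has_derivative[OF bounded_linear_vec_nth H])
  then have "(pd i g has_derivative (\<lambda>h. (A *v h) $ i)) (at x)"
    by (rule has_derivative_transform_within_open[OF _ assms(1,2)]) (simp add: pd_eq_gradient[OF G])
  then have "GDERIV (pd i g) x :> A $ i"
    by (simp add: gderiv_def matrix_vector_mul_component inner_commute)
  then have "grad (pd i g) x = A $ i"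
    by (simp add: grad_def pd_eq_gradient vec_eq_iff)
  then show ?thesis by (simp add: matrix_vector_mul_component)
qed

lemma has_vector_derivative_real2I:
  fixes z :: "real \<Rightarrow> real^2"
  assumes "((\<lambda>s. z s $ 1) has_real_derivative v $ 1) (at t within S)"
    and "((\<lambda>s. z s $ 2) has_real_derivative v $ 2) (at t within S)"
  shows "(z has_vector_derivative v) (at t within S)"
proof -
  have "((\<lambda>s. z s $ i) has_derivative (\<lambda>s. s * v $ i)) (at t within S)" for i
    using assms exhaust_2[of i] by (auto simp: has_field_derivative_def mult.commute[of _ "v $ _"])
  then show ?thesis
    unfolding has_vector_derivative_def
    by (subst has_derivative_componentwise_within) (auto simp: Basis_vec_def inner_axis)
qed

lemma C1_field_hamiltonian:
  fixes G :: "real^2 \<Rightarrow> real^2" and H :: "real^2 \<Rightarrow> real^2^2"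
  assumes "open D" "bounded D" "continuous_on (closure D) G" "continuous_on (closure D) H"
    and "\<And>x. x \<in> D \<Longrightarrow> (G has_derivative (\<lambda>h. H x *v h)) (at x)"
  shows "C1_field D (\<lambda>x. rot (G x)) (\<lambda>x. Blinfun (\<lambda>v. rot (H x *v v)))"
proof -
  have bl: "bounded_linear (\<lambda>v. rot (A *v v))" for A :: "real^2^2"
    by (intro bounded_linear_compose[OF bounded_linear_rot] matrix_vector_mul_bounded_linear)
  show ?thesis
  proof
    show "continuous_on (closure D) (\<lambda>x. rot (G x))"
      by (rule bounded_linear.continuous_on[OF bounded_linear_rot assms(3)])
    show "continuous_on (closure D) (\<lambda>x. Blinfun (\<lambda>v. rot (H x *v v)))"
    \<comment> \<open>In finite dimension, continuity in the operator norm follows from continuity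
      of the values at fixed vectors.\<close>
    proof (rule continuous_on_blinfun_componentwise)
      fix v :: "real^2"
      have "continuous_on (closure D) (\<lambda>x. H x *v v)"
        unfolding matrix_vector_mult_def by (intro continuous_intros assms(4))
      then show "continuous_on (closure D) (\<lambda>x. Blinfun (\<lambda>v. rot (H x *v v)) v)"
        by (simp add: bounded_linear_Blinfun_apply[OF bl] bounded_linear.continuous_on[OF bounded_linear_rot])
    qed
    show "((\<lambda>x. rot (G x)) has_derivative Blinfun (\<lambda>v. rot (H x *v v))) (at x)" if "x \<in> D" for x
      unfolding bounded_linear_Blinfun_apply[OF bl]
      by (rule bounded_linear.has_derivative[OF bounded_linear_rot assms(5)[OF that]])
  qed (use assms in auto)
qed

lemma hamiltonian_solution_integral_curve:
  assumes "hamiltonian_solution D h x0 z" and "\<And>x. x \<in> D \<Longrightarrow> GDERIV h x :> P x"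
  shows "integral_curve D (\<lambda>x. rot (P x)) z" "z 0 = x0"
proof -
  have "z t \<in> D" and "((\<lambda>s. z s $ 1) has_real_derivative - pd 2 h (z t)) (at t)"
    and "((\<lambda>s. z s $ 2) has_real_derivative pd 1 h (z t)) (at t)" for t
    using assms(1) by (auto simp: hamiltonian_solution_def)
  moreover from this(1) have "pd i h (z t) = P (z t) $ i" for i t
    by (intro pd_eq_gradient assms(2))
  ultimately show "integral_curve D (\<lambda>x. rot (P x)) z"
    unfolding integral_curve_def by (auto intro!: has_vector_derivative_real2I)
  show "z 0 = x0" using assms(1) by (simp add: hamiltonian_solution_def)
qed

text \<open>Along the curve the derivative of \<open>h\<close> is the inner product of the gradient
  with its own quarter turn, which vanishes.\<close>

lemma hamiltonian_conserved:
  assumes z: "integral_curve D (\<lambda>x. rot (P x)) z" and P: "\<And>x. x \<in> D \<Longrightarrow> GDERIV h x :> P x"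
  shows "h (z t) = h (z 0)"
proof (rule DERIV_isconst_all[of "\<lambda>t. h (z t)"], rule allI)
  fix s
  have "((\<lambda>t. h (z t)) has_derivative (\<lambda>d. (d *\<^sub>R rot (P (z s))) \<bullet> P (z s))) (at s)"
    using has_derivative_compose[OF integral_curveD(2)[OF z, unfolded has_vector_derivative_def]
        P[OF integral_curveD(1)[OF z], unfolded gderiv_def]] .
  moreover have "rot v \<bullet> v = 0" for v
    by (simp add: inner_vec_def sum_2)
  ultimately show "((\<lambda>t. h (z t)) has_real_derivative 0) (at s)"
    by (simp add: has_field_derivative_def lambda_zero)
qed

text \<open>By conservation of \<open>h\<close>, a second point of the horizontal line would give, by Rolle's
  theorem, a zero of \<open>\<partial>\<^sub>1 h\<close>.\<close>

lemma hamiltonian_return: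
  assumes z: "integral_curve D (\<lambda>x. rot (P x)) z" and P: "\<And>x. x \<in> D \<Longrightarrow> GDERIV h x :> P x"
    and ball: "ball (z 0) \<delta> \<subseteq> D" and nz: "\<And>x. x \<in> ball (z 0) \<delta> \<Longrightarrow> P x $ 1 \<noteq> 0"
    and t: "z t \<in> ball (z 0) \<delta>" "z t $ 2 = z 0 $ 2"
  shows "z t = z 0"
proof -
  define v where "v = z t - z 0"
  let ?p = "\<lambda>s::real. z 0 + s *\<^sub>R v"
  \<comment> \<open>The whole segment from \<open>z 0\<close> to \<open>z t\<close> stays in the
    ball, so \<open>h\<close> is differentiable along it and \<open>nz\<close> applies at the
    intermediate point.\<close>
  have p: "?p s \<in> ball (z 0) \<delta>" if "0 \<le> s" "s \<le> 1" for s
  proof -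
    have "norm (s *\<^sub>R v) \<le> norm v" using that by (simp add: mult_left_le_one_le)
    then show ?thesis using t(1) by (simp add: dist_norm v_def norm_minus_commute)
  qed
  have der: "((\<lambda>s. h (?p s)) has_real_derivative v \<bullet> P (?p s)) (at s)" if s: "0 \<le> s" "s \<le> 1" for s
  proof -
    have "(?p has_derivative (\<lambda>d. d *\<^sub>R v)) (at s)"
      by (auto intro!: derivative_eq_intros)
    moreover have "GDERIV h (?p s) :> P (?p s)"
      using P p[OF s] ball by blast
    ultimately have "((\<lambda>s. h (?p s)) has_derivative (\<lambda>d. (d *\<^sub>R v) \<bullet> P (?p s))) (at s)"
      unfolding gderiv_def by (rule has_derivative_compose)
    then show ?thesis
      by (simp add: has_field_derivative_def mult.commute[of _ "v \<bullet> _"])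
  qed
  obtain s where s: "0 < s" "s < 1" "h (?p 1) - h (?p 0) = (1 - 0) * (v \<bullet> P (?p s))"
    using MVT2[OF zero_less_one der] by blast
  then have "v \<bullet> P (?p s) = 0"
    using hamiltonian_conserved[OF z P, of t] by (simp add: v_def)
  \<comment> \<open>Since \<open>v\<close> is horizontal, the inner product reduces to
    \<open>v $ 1\<close> times a nonzero first partial derivative.\<close>
  then have "v $ 1 = 0"
    using nz[OF p[of s]] s t(2) by (simp add: inner_vec_def sum_2 v_def)
  with t(2) show ?thesis
    by (simp add: v_def vec_eq_iff forall_2)
qed

section \<open>Derivative of the period of a Hamiltonian trajectory\<close>

theorem proposition4p2:
  fixes D :: "(real^2) set" and x0 :: "real^2" and F :: "(real^2 \<Rightarrow> real) set"
    and g r :: "real^2 \<Rightarrow> real"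
    and z w :: "real \<Rightarrow> real^2" and T :: real
    and zl :: "real \<Rightarrow> real \<Rightarrow> real^2" and Tl :: "real \<Rightarrow> real"
  assumes "open D" and "connected D" and "bounded D" and "C11_boundary D"
    and "x0 \<in> D"
    and "F \<subseteq> C2_closure D" and "\<forall>f\<in>F. admissible D x0 f"
    and "g \<in> F" and "r \<in> F"
    and "hamiltonian_solution D g x0 z" and "is_minimal_period z T"
    and "\<forall>\<^sub>F l in at 0. hamiltonian_solution D (\<lambda>x. g x + l * r x) x0 (zl l) \<and> is_minimal_period (zl l) (Tl l)"
    and "linearized_solution g r z T w"
    and "deriv (\<lambda>t. z t $ 2) T \<noteq> 0"
  shows "((\<lambda>l. (Tl l - T) / l) \<longlongrightarrow> - (w T $ 2) / deriv (\<lambda>t. z t $ 2) T) (at 0)"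
proof -
  obtain G H where G: "continuous_on (closure D) G" "continuous_on (closure D) H"
    "\<And>x. x \<in> D \<Longrightarrow> GDERIV g x :> G x" "\<And>x. x \<in> D \<Longrightarrow> (G has_derivative (\<lambda>h. H x *v h)) (at x)"
    using assms(6,8) unfolding C2_closure_def by blast
  obtain R S where R: "continuous_on (closure D) R" "continuous_on (closure D) S"
    "\<And>x. x \<in> D \<Longrightarrow> GDERIV r x :> R x" "\<And>x. x \<in> D \<Longrightarrow> (R has_derivative (\<lambda>h. S x *v h)) (at x)"
    using assms(6,9) unfolding C2_closure_def by blast
  define X' where "X' = (\<lambda>x. Blinfun (\<lambda>v. rot (H x *v v)))"
  define Y' where "Y' = (\<lambda>x. Blinfun (\<lambda>v. rot (S x *v v)))"
  have X'_apply: "X' x v = rot (H x *v v)" for x v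
    unfolding X'_def
    by (simp add: bounded_linear_Blinfun_apply bounded_linear_compose[OF bounded_linear_rot])
  interpret C1_perturbation D "\<lambda>x. rot (G x)" X' "\<lambda>x. rot (R x)" Y'
    unfolding C1_perturbation_def X'_def Y'_def
    using C1_field_hamiltonian[OF assms(1,3) G(1,2,4)] C1_field_hamiltonian[OF assms(1,3) R(1,2,4)]
    by blast
  have z: "integral_curve D (\<lambda>x. rot (G x)) z" and z0: "z 0 = x0"
    using hamiltonian_solution_integral_curve[OF assms(10) G(3)] by auto
  have zT: "z T = x0"
    using assms(11) z0 unfolding is_minimal_period_def by (metis add_0)
  have dh: "GDERIV (\<lambda>x. g x + l * r x) x :> G x + l *\<^sub>R R x" if "x \<in> D" for l x
    using GDERIV_add[OF G(3)[OF that] GDERIV_mult[OF GDERIV_const[of l x] R(3)[OF that]]] by simp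
  have V: "rot (G x + l *\<^sub>R R x) = rot (G x) + l *\<^sub>R rot (R x)" for l x
    by (simp add: rot_add rot_scaleR)
  have zl: "\<forall>\<^sub>F l in at 0. integral_curve D (\<lambda>x. rot (G x) + l *\<^sub>R rot (R x)) (zl l) \<and> zl l 0 = z 0 \<and>
      is_minimal_period (zl l) (Tl l)"
    using assms(12)
  proof eventually_elim
    case (elim l)
    then show ?case
      using hamiltonian_solution_integral_curve[OF conjunct1[OF elim] dh] z0 by (simp add: V)
  qed
  have "((\<lambda>t. z t $ 2) has_real_derivative pd 1 g (z T)) (at T)"
    using assms(10) by (simp add: hamiltonian_solution_def)
  \<comment> \<open>The direction \<open>e\<close> is \<open>axis 2 1\<close>: as \<open>z\<close>
    is back at \<open>x0\<close> at time \<open>T\<close>, the assumption on the derivative of the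
    second component says exactly that the field is transversal at the initial point.\<close>
  then have deriv: "deriv (\<lambda>t. z t $ 2) T = rot (G (z 0)) \<bullet> axis 2 1"
    using pd_eq_gradient[OF G(3)[OF assms(5)], of 1]
    by (simp add: DERIV_imp_deriv inner_axis zT z0)
  obtain \<delta> where \<delta>: "\<delta> > 0" "ball (z 0) \<delta> \<subseteq> D"
    "\<forall>\<^sub>F l in nhds 0. \<forall>x\<in>ball (z 0) \<delta>.
      (rot (G (z 0)) \<bullet> axis 2 1) * ((rot (G x) + l *\<^sub>R rot (R x)) \<bullet> axis 2 1) > 0"
    using transversal_nearby[OF integral_curveD(1)[OF z]] assms(14) unfolding deriv by blast
  then have "\<forall>\<^sub>F l in at 0. \<forall>x\<in>ball (z 0) \<delta>.
      (rot (G (z 0)) \<bullet> axis 2 1) * ((rot (G x) + l *\<^sub>R rot (R x)) \<bullet> axis 2 1) > 0"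
    by (simp add: eventually_at_filter eventually_mono)
  with zl have return: "\<forall>\<^sub>F l in at 0. \<forall>t. zl l t \<in> ball (z 0) \<delta> \<and> zl l t \<bullet> axis 2 1 = z 0 \<bullet> axis 2 1
      \<longrightarrow> zl l t = z 0"
  proof eventually_elim
    case (elim l)
    \<comment> \<open>The second component of \<open>rot v\<close> is \<open>v $ 1\<close>, so
      positivity of the product excludes zeros of the first partial derivative of the perturbed
      energy.\<close>
    have nz: "(G x + l *\<^sub>R R x) $ 1 \<noteq> 0" if "x \<in> ball (z 0) \<delta>" for x
      using elim that by (fastforce simp: inner_axis)
    have curve: "integral_curve D (\<lambda>x. rot (G x + l *\<^sub>R R x)) (zl l)" and init: "zl l 0 = z 0"
      using elim by (simp_all add: V)
    show ?case
    proof (intro allI impI)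
      fix t assume "zl l t \<in> ball (z 0) \<delta> \<and> zl l t \<bullet> axis 2 1 = z 0 \<bullet> axis 2 1"
      then have t: "zl l t \<in> ball (zl l 0) \<delta>" "zl l t $ 2 = zl l 0 $ 2"
        by (simp_all add: init inner_axis)
      have "zl l t = zl l 0"
        by (rule hamiltonian_return[OF curve dh _ _ t]) (use nz \<delta>(2) init in auto)
      then show "zl l t = z 0" by (simp add: init)
    qed
  qed
  \<comment> \<open>The componentwise linearized system is the variational equation of the field
    \<open>rot (G x)\<close>, with \<open>rot (R x)\<close> as the inhomogeneity.\<close>
  have w: "(w has_vector_derivative X' (z t) (w t) + rot (R (z t))) (at t within {0..T})"
    if "t \<in> {0..T}" for t
  proof -
    note D = integral_curveD(1)[OF z, of t]
    have "grad (pd i g) (z t) \<bullet> w t = (H (z t) *v w t) $ i" for i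
      by (rule grad_pd_inner[OF assms(1) D G(3) G(4)[OF D]])
    moreover have "pd i r (z t) = R (z t) $ i" for i
      by (rule pd_eq_gradient[OF R(3)[OF D]])
    moreover have
      "((\<lambda>s. w s $ 1) has_real_derivative - (grad (pd 2 g) (z t) \<bullet> w t) - pd 2 r (z t)) (at t within {0..T})"
      "((\<lambda>s. w s $ 2) has_real_derivative grad (pd 1 g) (z t) \<bullet> w t + pd 1 r (z t)) (at t within {0..T})"
      using assms(13) that by (auto simp: linearized_solution_def)
    ultimately show ?thesis
      by (intro has_vector_derivative_real2I) (simp_all add: X'_apply)
  qed
  have w0: "w 0 = 0"
    using assms(13) by (simp add: linearized_solution_def vec_eq_iff forall_2)
  have "((\<lambda>l. (Tl l - T) / l) \<longlongrightarrow> - (w T \<bullet> axis 2 1) / (rot (G (z 0)) \<bullet> axis 2 1)) (at 0)"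
    using assms(14) unfolding deriv
    by (intro period_derivative[OF z assms(11) zl w w0 _ \<delta>(1) return])
  then show ?thesis
    unfolding deriv by (simp add: inner_axis)
qed

end
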